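(* Let $U\subset\mathbb{R}^{N_i}$ be compact and let $\mathcal{U}=U^{\mathbb{Z}}$ be the compact metric space of admissible input sequences with the metric $d_{\mathcal{U}}(\mathbf{u},\mathbf{v})=\sum_{k\in\mathbb{Z}}2^{-|k|}d_U(u[k],v[k])$. Let $\sigma:\mathcal{U}\to\mathcal{U}$ be the shift operator, and let $(\sigma,\Phi)$ be the skew product flow on the complete metric space $(X,d_X)$, where $X\subseteq\mathbb{R}^{N_r}$ is closed, $d_X$ is the Euclidean distance and $\Phi$ is the cocycle map. Let $\mathbf{v}\in\mathcal{U}$ and let $\mathcal{V}:=\{\sigma^n(\mathbf{v}):n\in\mathbb{Z}\}\subseteq\mathcal{U}$. If there exists a nonempty compact subset $B\subset X$ which is pullback absorbing and positively invariant for $\mathcal{V}$, then there exists the (global) pullback attractor $\mathbf{A}(\mathbf{v})=\{A_n\}_{n\in\mathbb{Z}}$ of the dynamics driven by $\mathbf{v}$, and it has component sets $$A_n=\bigcap_{m\le n}\Phi(n-m,\sigma^m(\mathbf{v}),B),\qquad n\in\mathbb{Z}.$$ In addition, if $\mathcal{V}$ is compact in $(\mathcal{U},d_{\mathcal{U}})$, then $A(\mathcal{V}):=\overline{\bigcup_{n\in\mathbb{Z}}A_n}\subset B$ uniformly (in time) attracts the whole phase space driven by $\mathbf{v}$, that is $$\lim_{k\to\infty}\ \sup_{n\in\mathbb{Z}}\ h\big(\Phi(k,\sigma^n(\mathbf{v}),X),A(\mathcal{V})\big)=0.$$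
   Context: $d_U$ is the Euclidean distance on $U$. The system is $x[k+1]=G(u[k+1],x[k])$ with $G:U\times X\to X$; the paper's standing assumptions are that $G$ is $C^1$ and that each $G(u,\cdot)$ is a local diffeomorphism onto its image. The shift is $\sigma(\mathbf{u})=\{u[k+1]\}_{k\in\mathbb{Z}}$ for $\mathbf{u}=\{u[k]\}_{k\in\mathbb{Z}}$. The cocycle map $\Phi:\mathbb{Z}_{\ge0}\times\mathcal{U}\times X\to X$ is $\Phi(0,\mathbf{u},x_0)=x_0$ and $\Phi(n,\mathbf{u},x_0)=G(u[n],\Phi(n-1,\mathbf{u},x_0))$ for $n\ge1$; $\Phi(n,\mathbf{u},D)$ is the image of $D\subseteq X$. The Hausdorff semi-distance is $h(Y,Z)=\sup_{y\in Y}\inf_{z\in Z}d_X(y,z)$; $\overline{D}$ is the closure of $D$. A nonempty compact $B\subseteq X$ is pullback absorbing for a family $\mathcal{V}\subseteq\mathcal{U}$ if for every $\mathbf{u}\in\mathcal{V}$ and every bounded $D\subseteq X$ there is $N=N(\mathbf{u},D)\in\mathbb{Z}_{\ge0}$ with $\Phi(n,\sigma^{-n}(\mathbf{u}),D)\subseteq B$ for all $n\ge N$. It is positively invariant for $\mathcal{V}$ if $\Phi(k,\mathbf{u},B)\subseteq B$ for all $\mathbf{u}\in\mathcal{V}$ and $k\ge0$. A (global) pullback attractor for input $\mathbf{v}$ is a family $\{A_n\}_{n\in\mathbb{Z}}$ of nonempty compact sets that is invariant, i.e. $\Phi(s,\sigma^m(\mathbf{v}),A_m)=A_{s+m}$ for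 all $m\in\mathbb{Z}$, $s\ge0$, and pullback attracting, i.e. $\lim_{k\to\infty}h(\Phi(k,\sigma^{-k+n}(\mathbf{v}),D),A_n)=0$ for all $n\in\mathbb{Z}$ and all bounded $D\subseteq X$. (When $X$ is bounded this is equivalent to requiring it for $D=X$ only.)
   Formalization: For unbounded X the final limit can fail (X=R, G(u,x)=x/2, B=[-1,1]); it is stated for the whole of X only if for some k all sets Φ(k,σ^n(v),X) are bounded (automatic for bounded X, and necessary), and for every bounded D⊆X without that condition. *)

theory Defs
  imports "HOL-Analysis.Analysis"
begin

(* A map on an arbitrary subset of a Euclidean space is C^1 if near each point of the set it
   agrees, on the set, with a C^1 map defined on an open neighbourhood. *)
definition C1_on :: "('a::euclidean_space \<Rightarrow> 'b::euclidean_space) \<Rightarrow> 'a set \<Rightarrow> bool" where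
  "C1_on f S \<longleftrightarrow>
     (\<forall>p\<in>S. \<exists>W g g'. open W \<and> p \<in> W \<and> (\<forall>x\<in>S \<inter> W. g x = f x) \<and>
        (\<forall>x\<in>W. (g has_derivative blinfun_apply (g' x)) (at x)) \<and> continuous_on W g')"

(* Every point of S has a relatively open neighbourhood that f maps diffeomorphically onto its
   image. The image is not required to be relatively open in f ` S, so maps satisfying the
   variant with that additional requirement are included. *)
definition local_diffeo_onto_image ::
    "('a::euclidean_space \<Rightarrow> 'b::euclidean_space) \<Rightarrow> 'a set \<Rightarrow> bool" where
  "local_diffeo_onto_image f S \<longleftrightarrow>
     (\<forall>x\<in>S. \<exists>W. open W \<and> x \<in> W \<and> inj_on f (S \<inter> W) \<and> C1_on f (S \<inter> W) \<and>
        C1_on (inv_into (S \<inter> W) f) (f ` (S \<inter> W)))"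

definition input_seqs :: "'u set \<Rightarrow> (int \<Rightarrow> 'u) set" where
  "input_seqs U = {u. \<forall>k. u k \<in> U}"

(* The sum converges for sequences in a bounded set, see Metric_space_input_seqs. *)
definition seq_dist :: "(int \<Rightarrow> 'u::metric_space) \<Rightarrow> (int \<Rightarrow> 'u) \<Rightarrow> real" where
  "seq_dist u v = (\<Sum>\<^sub>\<infinity>k::int. 2 powi (- \<bar>k\<bar>) * dist (u k) (v k))"

definition shift :: "(int \<Rightarrow> 'u) \<Rightarrow> (int \<Rightarrow> 'u)" where
  "shift u = (\<lambda>k. u (k + 1))"

definition shift_pow :: "int \<Rightarrow> (int \<Rightarrow> 'u) \<Rightarrow> (int \<Rightarrow> 'u)" where
  "shift_pow n = (if 0 \<le> n then shift ^^ nat n else inv shift ^^ nat (- n))"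

definition shift_orbit :: "(int \<Rightarrow> 'u) \<Rightarrow> (int \<Rightarrow> 'u) set" where
  "shift_orbit v = range (\<lambda>n. shift_pow n v)"

primrec cocycle :: "('u \<times> 'x \<Rightarrow> 'x) \<Rightarrow> nat \<Rightarrow> (int \<Rightarrow> 'u) \<Rightarrow> 'x \<Rightarrow> 'x" where
  "cocycle G 0 u x = x"
| "cocycle G (Suc n) u x = G (u (int (Suc n)), cocycle G n u x)"

(* Extended-valued: it is infinite if Y is not within finite distance of Z. *)
definition hausdorff_semidist :: "'x::metric_space set \<Rightarrow> 'x set \<Rightarrow> ennreal" where
  "hausdorff_semidist Y Z = (SUP y\<in>Y. INF z\<in>Z. ennreal (dist y z))"

definition pullback_absorbing ::
    "'x::metric_space set \<Rightarrow> ('u \<times> 'x \<Rightarrow> 'x) \<Rightarrow> (int \<Rightarrow> 'u) set \<Rightarrow> 'x set \<Rightarrow> bool" where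
  "pullback_absorbing X G V B \<longleftrightarrow>
     B \<noteq> {} \<and> compact B \<and> B \<subseteq> X \<and>
     (\<forall>u\<in>V. \<forall>D. D \<subseteq> X \<and> bounded D \<longrightarrow>
        (\<exists>N. \<forall>n\<ge>N. cocycle G n (shift_pow (- int n) u) ` D \<subseteq> B))"

definition positively_invariant ::
    "('u \<times> 'x \<Rightarrow> 'x) \<Rightarrow> (int \<Rightarrow> 'u) set \<Rightarrow> 'x set \<Rightarrow> bool" where
  "positively_invariant G V B \<longleftrightarrow> (\<forall>u\<in>V. \<forall>k. cocycle G k u ` B \<subseteq> B)"

definition pullback_attractor ::
    "'x::metric_space set \<Rightarrow> ('u \<times> 'x \<Rightarrow> 'x) \<Rightarrow> (int \<Rightarrow> 'u) \<Rightarrow> (int \<Rightarrow> 'x set) \<Rightarrow> bool" where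
  "pullback_attractor X G v A \<longleftrightarrow>
     (\<forall>n. A n \<noteq> {} \<and> compact (A n) \<and> A n \<subseteq> X) \<and>
     (\<forall>m s. cocycle G s (shift_pow m v) ` A m = A (int s + m)) \<and>
     (\<forall>n D. D \<subseteq> X \<and> bounded D \<longrightarrow>
        (\<lambda>k. hausdorff_semidist (cocycle G k (shift_pow (- int k + n) v) ` D) (A n))
          \<longlonglongrightarrow> 0)"

definition uniformly_attracts ::
    "('u \<times> 'x \<Rightarrow> 'x::metric_space) \<Rightarrow> (int \<Rightarrow> 'u) \<Rightarrow> 'x set \<Rightarrow> 'x set \<Rightarrow> bool" where
  "uniformly_attracts G v D A \<longleftrightarrow>
     (\<lambda>k. SUP n::int. hausdorff_semidist (cocycle G k (shift_pow n v) ` D) A) \<longlonglongrightarrow> 0"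

lemma shift_pow_apply: "shift_pow n u k = u (k + n)"
proof -
  have 1: "(shift ^^ m) w k = w (k + int m)" for m w k
    by (induction m arbitrary: k) (auto simp: shift_def algebra_simps)
  have "inj shift"
    by (rule injI, rule ext) (metis shift_def diff_add_cancel)
  moreover have "shift (\<lambda>k. w (k - 1)) = w" for w :: "int \<Rightarrow> 'a"
    by (simp add: shift_def)
  ultimately have inv: "inv shift w = (\<lambda>k. w (k - 1))" for w :: "int \<Rightarrow> 'a"
    by (metis inv_f_eq)
  have 2: "((inv shift) ^^ m) w k = w (k - int m)" for m k and w :: "int \<Rightarrow> 'a"
    by (induction m arbitrary: k) (auto simp: inv algebra_simps)
  show ?thesis by (simp add: shift_pow_def 1 2)
qed

lemma summable_two_powi: "(\<lambda>k::int. 2 powi (- \<bar>k\<bar>) :: real) summable_on UNIV"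
proof -
  have g: "(\<lambda>n::nat. (1/2::real) ^ n) summable_on UNIV"
    by (rule norm_summable_imp_summable_on) (simp add: summable_geometric)
  have "(\<lambda>k::int. 2 powi (- \<bar>k\<bar>) :: real) summable_on range int"
    using g by (subst summable_on_reindex)
      (auto simp: o_def power_int_minus power_one_over inverse_eq_divide)
  moreover have "(\<lambda>k::int. 2 powi (- \<bar>k\<bar>) :: real) summable_on range (\<lambda>n. - int n)"
    using g by (subst summable_on_reindex)
      (auto simp: o_def power_int_minus power_one_over inverse_eq_divide inj_on_def)
  moreover have "range int \<union> range (\<lambda>n. - int n) = UNIV"
    by (auto simp: image_iff) (metis int_cases2)
  ultimately show ?thesis by (metis summable_on_union)
qed

lemma summable_seq_dist:
  fixes U :: "'u::metric_space set"
  assumes "bounded U" "u \<in> input_seqs U" "v \<in> input_seqs U"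
  shows "(\<lambda>k::int. 2 powi (- \<bar>k\<bar>) * dist (u k) (v k)) summable_on UNIV"
proof (rule summable_on_comparison_test)
  show "(\<lambda>k::int. 2 powi (- \<bar>k\<bar>) * diameter U) summable_on UNIV"
    by (rule summable_on_cmult_left[OF summable_two_powi])
  show "2 powi (- \<bar>k\<bar>) * dist (u k) (v k) \<le> 2 powi (- \<bar>k\<bar>) * diameter U" for k
    using assms by (intro mult_left_mono diameter_bounded_bound) (auto simp: input_seqs_def)
qed auto

lemma Metric_space_input_seqs:
  fixes U :: "'u::metric_space set"
  assumes "bounded U"
  shows "Metric_space (input_seqs U) seq_dist"
proof
  fix u v w :: "int \<Rightarrow> 'u"
  show "0 \<le> seq_dist u v" unfolding seq_dist_def by (rule infsum_nonneg) simp
  show "seq_dist u v = seq_dist v u" by (simp add: seq_dist_def dist_commute)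
  assume u: "u \<in> input_seqs U" and v: "v \<in> input_seqs U"
  note s = summable_seq_dist[OF assms]
  show "seq_dist u v = 0 \<longleftrightarrow> u = v"
  proof
    assume "seq_dist u v = 0"
    then have "2 powi (- \<bar>k\<bar>) * dist (u k) (v k) = 0" for k :: int
      unfolding seq_dist_def
      using nonneg_infsum_le_0D[of "\<lambda>k. 2 powi (- \<bar>k\<bar>) * dist (u k) (v k)" UNIV k] s[OF u v]
      by simp
    then show "u = v" by auto
  qed (simp add: seq_dist_def)
  assume w: "w \<in> input_seqs U"
  have "seq_dist u w \<le> (\<Sum>\<^sub>\<infinity>k::int. 2 powi (- \<bar>k\<bar>) * dist (u k) (v k)
      + 2 powi (- \<bar>k\<bar>) * dist (v k) (w k))"
    unfolding seq_dist_def using s[OF u w] s[OF u v] s[OF v w]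
    by (intro infsum_mono summable_on_add)
      (auto simp flip: distrib_left intro!: mult_left_mono dist_triangle)
  also have "\<dots> = seq_dist u v + seq_dist v w"
    unfolding seq_dist_def by (rule infsum_add) (use s[OF u v] s[OF v w] in auto)
  finally show "seq_dist u w \<le> seq_dist u v + seq_dist v w" .
qed

end

theory Submission
  imports Defs
begin

text \<open>
  Let $\Phi$ be the cocycle and $\sigma$ the shift. For a fixed time $n$ the sets
  $\Phi(j, \sigma^{n-j} v, B)$ form a decreasing sequence of nonempty compact sets, because $B$ is
  positively invariant; $A_n$ is their intersection. Such a sequence has nonempty intersection, its
  intersection commutes with continuous images (which gives invariance), and its members eventually
  lie in every neighbourhood of the intersection. The last fact gives pullback attraction: starting
  far enough in the past, a bounded set has been absorbed by $B$ at time $n-j$ and hence lies in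
  $\Phi(j, \sigma^{n-j} v, B)$ at time $n$.

  Pullback absorption times may depend on the input, so uniform attraction over all $n$ needs more
  than the first part. The point is that a compact shift orbit is finite (the input is periodic):
  a nonempty countable compact space has an isolated point by Baire's theorem, the shift moves
  this point to every other point of the orbit, so the orbit is compact and discrete. Since
  $\Phi(k, \sigma^n v, D) = \Phi(k, \sigma^{-k} w, D)$ with $w = \sigma^{n+k} v$ in the orbit,
  forward attraction uniform in $n$ is pullback attraction for finitely many inputs $w$ at once
  (\<open>forward_attraction\<close>). If $\Phi(k, \sigma^n v, X)$ is bounded for every $n$, the union of
  these finitely many sets is a bounded set that captures the whole space after $k$ steps, which
  reduces the attraction of $X$ to that of a bounded set.
\<close>

section \<open>Algebra of the cocycle\<close>

lemma shift_pow_shift_pow: "shift_pow a (shift_pow b w) = shift_pow (a + b) w"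
  by (rule ext) (simp add: shift_pow_apply algebra_simps)

lemma shift_pow_0 [simp]: "shift_pow 0 w = w"
  by (rule ext) (simp add: shift_pow_apply)

lemma cocycle_add:
  "cocycle G (j + k) w x = cocycle G j (shift_pow (int k) w) (cocycle G k w x)"
  by (induction j) (simp_all add: shift_pow_apply algebra_simps)

lemma shift_pow_in_orbit [simp]: "shift_pow m v \<in> shift_orbit v"
  by (auto simp: shift_orbit_def)

section \<open>Nested compact sets and the Hausdorff semi-distance\<close>

lemma compact_nest_meets:
  fixes K :: "nat \<Rightarrow> 'a::heine_borel set"
  assumes "\<And>n. compact (K n)" and "antimono K" and "closed C" and "\<And>n. C \<inter> K n \<noteq> {}"
  shows "C \<inter> (\<Inter>n. K n) \<noteq> {}"
proof -
  have "(\<Inter>n. C \<inter> K n) \<noteq> {}"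
  proof (rule compact_nest)
    show "C \<inter> K n \<subseteq> C \<inter> K m" if "m \<le> n" for m n
      using antimonoD[OF \<open>antimono K\<close> that] by blast
  qed (use assms in \<open>simp_all add: closed_Int_compact\<close>)
  then show ?thesis by auto
qed

text \<open>For the nontrivial inclusion, the fibre of \<open>f\<close> over a point \<open>y\<close> that is attained on every
  \<open>K n\<close> is a closed set that meets every \<open>K n\<close>.\<close>

lemma image_compact_nest:
  fixes K :: "nat \<Rightarrow> 'a::heine_borel set" and f :: "'a \<Rightarrow> 'b::t1_space"
  assumes K: "\<And>n. compact (K n)" and "antimono K" and f: "continuous_on (K 0) f"
  shows "f ` (\<Inter>n. K n) = (\<Inter>n. f ` K n)"
proof
  show "(\<Inter>n. f ` K n) \<subseteq> f ` (\<Inter>n. K n)"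
  proof
    fix y assume y: "y \<in> (\<Inter>n. f ` K n)"
    define C where "C = {x \<in> K 0. f x = y}"
    have "closed C"
      unfolding C_def using continuous_closed_preimage_constant[OF f] K[of 0] compact_imp_closed
      by blast
    moreover have "K n \<subseteq> K 0" for n using \<open>antimono K\<close> by (simp add: antimonoD)
    then have "C \<inter> K n \<noteq> {}" for n using y by (fastforce simp: C_def)
    ultimately show "y \<in> f ` (\<Inter>n. K n)"
      using compact_nest_meets[OF K \<open>antimono K\<close>, of C] by (auto simp: C_def)
  qed
qed auto

text \<open>The points at distance at least \<open>e\<close> from the intersection form a closed set; if it met every
  member of the sequence, it would meet the intersection itself.\<close>

lemma compact_nest_nearby:
  fixes K :: "nat \<Rightarrow> 'a::heine_borel set"
  assumes "\<And>n. compact (K n)" and "antimono K" and "e > 0"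
  shows "\<exists>n. \<forall>y\<in>K n. \<exists>z\<in>(\<Inter>n. K n). dist y z < e"
proof (rule ccontr)
  assume *: "\<nexists>n. \<forall>y\<in>K n. \<exists>z\<in>(\<Inter>n. K n). dist y z < e"
  define C where "C = (\<Inter>z\<in>(\<Inter>n. K n). {y. e \<le> dist y z})"
  have "closed C"
    unfolding C_def by (intro closed_INT ballI closed_Collect_le continuous_intros)
  moreover have "C \<inter> K n \<noteq> {}" for n using * by (fastforce simp: C_def not_less)
  ultimately have "C \<inter> (\<Inter>n. K n) \<noteq> {}" by (rule compact_nest_meets[OF assms(1,2)])
  then show False using \<open>e > 0\<close> by (force simp: C_def)
qed

lemma hausdorff_semidist_le:
  assumes "\<And>y. y \<in> Y \<Longrightarrow> \<exists>z\<in>Z. dist y z < e"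
  shows "hausdorff_semidist Y Z \<le> ennreal e"
  unfolding hausdorff_semidist_def
proof (rule SUP_least)
  fix y assume "y \<in> Y"
  then obtain z where "z \<in> Z" "dist y z < e" using assms by blast
  then show "(INF z\<in>Z. ennreal (dist y z)) \<le> ennreal e"
    by (intro INF_lower2[of z]) (auto intro: ennreal_leI)
qed

lemma hausdorff_semidist_mono:
  "Y \<subseteq> Y' \<Longrightarrow> Z' \<subseteq> Z \<Longrightarrow> hausdorff_semidist Y Z \<le> hausdorff_semidist Y' Z'"
  unfolding hausdorff_semidist_def by (intro SUP_subset_mono INF_superset_mono) auto

lemma tendsto_0_ennrealI:
  fixes f :: "'a \<Rightarrow> ennreal"
  assumes "\<And>e. e > 0 \<Longrightarrow> eventually (\<lambda>k. f k \<le> ennreal e) F"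
  shows "(f \<longlongrightarrow> 0) F"
proof (rule order_tendstoI)
  fix a :: ennreal assume "0 < a"
  then obtain b where b: "0 < b" "b < a" using dense by blast
  then obtain e where "b = ennreal e" "e > 0"
    by (cases b) (auto simp: ennreal_zero_less_top)
  with assms[of e] b show "\<forall>\<^sub>F k in F. f k < a"
    by (auto elim!: eventually_mono)
qed auto

section \<open>Compact shift orbits are finite\<close>

text \<open>The singletons are countably many closed sets that cover the space, so by Baire's theorem one
  of them has an interior point.\<close>

lemma compact_countable_isolated_point:
  fixes S :: "'a::metric_space set"
  assumes "compact S" and "countable S" and "S \<noteq> {}"
  obtains T s where "open T" "S \<inter> T = {s}"
proof -
  let ?S = "top_of_set S" and ?\<G> = "(\<lambda>s. {s}) ` S"
  have "compact_space ?S" using \<open>compact S\<close> by (simp add: compact_space_subtopology)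
  moreover have "Hausdorff_space ?S" by (simp add: Hausdorff_space_subtopology)
  ultimately have "locally_compact_space ?S \<and> regular_space ?S"
    using compact_Hausdorff_imp_regular_space compact_imp_locally_compact_space by blast
  moreover have "?S interior_of \<Union>?\<G> \<noteq> {}"
    using \<open>S \<noteq> {}\<close> interior_of_topspace[of ?S] by simp
  moreover have "closedin ?S {s}" if "s \<in> S" for s
    using that closedin_Hausdorff_singleton[OF \<open>Hausdorff_space ?S\<close>] by simp
  ultimately have "\<exists>t\<in>?\<G>. ?S interior_of t \<noteq> {}"
    using Baire_category_alt[of ?S ?\<G>] countable_image[OF \<open>countable S\<close>, of "\<lambda>s. {s}"]
    by (metis (no_types, lifting) imageE)
  then obtain s where "s \<in> S" "?S interior_of {s} \<noteq> {}" by blast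
  then have "openin ?S {s}"
    by (metis interior_of_subset openin_interior_of subset_singletonD)
  then show ?thesis using that by (auto simp: openin_open)
qed

lemma continuous_on_shift_pow:
  "continuous_on A (shift_pow n :: (int \<Rightarrow> 'a::topological_space) \<Rightarrow> _)"
  by (rule continuous_on_coordinatewise_then_product)
    (auto simp: shift_pow_apply intro: continuous_on_subset[OF continuous_on_product_coordinates])

text \<open>Compactness refers to the product topology on sequences, for which the shift is visibly
  continuous. Pulling back a neighbourhood that isolates one point along the powers of the shift
  isolates every point of the orbit, and finitely many of these neighbourhoods cover it.\<close>

lemma compact_shift_orbit_finite:
  fixes v :: "int \<Rightarrow> 'a::metric_space"
  assumes "compact (shift_orbit v)"
  shows "finite (shift_orbit v)"
proof -
  let ?V = "shift_orbit v"
  have "countable ?V" by (simp add: shift_orbit_def)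
  then obtain T s where T: "open T" "?V \<inter> T = {s}"
    using compact_countable_isolated_point[OF assms] by (metis empty_iff shift_pow_in_orbit)
  then obtain a where s: "s = shift_pow a v" by (auto simp: shift_orbit_def)
  define W where "W n = shift_pow n -` T" for n
  have opn: "open (W n)" for n
    unfolding W_def using continuous_on_shift_pow \<open>open T\<close> by (rule open_vimage[rotated])
  have W: "?V \<inter> W n \<subseteq> {shift_pow (a - n) v}" for n
  proof
    fix w assume "w \<in> ?V \<inter> W n"
    then have "shift_pow n w \<in> ?V \<inter> T"
      by (auto simp: W_def shift_orbit_def shift_pow_shift_pow)
    then have "shift_pow (- n) (shift_pow n w) = shift_pow (- n) s" using T by simp
    then show "w \<in> {shift_pow (a - n) v}"
      by (simp add: s shift_pow_shift_pow)
  qed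
  have "?V \<subseteq> (\<Union>n. W n)"
  proof
    fix w assume "w \<in> ?V"
    then obtain m where "w = shift_pow m v" by (auto simp: shift_orbit_def)
    then have "w \<in> W (a - m)" using T s by (auto simp: W_def shift_pow_shift_pow)
    then show "w \<in> (\<Union>n. W n)" by blast
  qed
  then obtain I where "finite I" "?V \<subseteq> (\<Union>n\<in>I. W n)"
    using compactE_image[OF assms, of UNIV W] opn by metis
  then have "?V \<subseteq> (\<lambda>n. shift_pow (a - n) v) ` I" using W by blast
  then show ?thesis using \<open>finite I\<close> finite_surj by blast
qed

lemma dist_coordinate_le_seq_dist:
  fixes U :: "'u::metric_space set"
  assumes "bounded U" "u \<in> input_seqs U" "w \<in> input_seqs U"
  shows "dist (u k) (w k) \<le> 2 powi \<bar>k\<bar> * seq_dist u w"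
proof -
  have "2 powi (- \<bar>k\<bar>) * dist (u k) (w k) \<le> seq_dist u w"
    unfolding seq_dist_def
    using infsum_mono_neutral[of "\<lambda>k. 2 powi (- \<bar>k\<bar>) * dist (u k) (w k)" "{k}"
        "\<lambda>k. 2 powi (- \<bar>k\<bar>) * dist (u k) (w k)" UNIV] summable_seq_dist[OF assms]
    by simp
  then show ?thesis by (simp add: power_int_minus field_simps)
qed

text \<open>The weighted metric controls each coordinate, so the identity is continuous from its topology
  to the product topology and preserves compactness.\<close>

lemma compactin_seq_dist_imp_compact:
  fixes U :: "'u::metric_space set"
  assumes "bounded U" and V: "compactin (Metric_space.mtopology (input_seqs U) seq_dist) V"
  shows "compact V"
proof -
  interpret M: Metric_space "input_seqs U" seq_dist
    using \<open>bounded U\<close> by (rule Metric_space_input_seqs)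
  have "continuous_map M.mtopology euclidean (\<lambda>u. u k)" for k :: int
    unfolding mtopology_is_euclidean[symmetric]
      M.metric_continuous_map[OF Met_TC.Metric_space_axioms]
  proof (intro conjI ballI allI impI)
    fix u :: "int \<Rightarrow> 'u" and e :: real assume u: "u \<in> input_seqs U" and "e > 0"
    have "dist (u k) (w k) < e"
      if "w \<in> input_seqs U" "seq_dist u w < e / 2 powi \<bar>k\<bar>" for w
      using dist_coordinate_le_seq_dist[OF \<open>bounded U\<close> u that(1), of k] that(2)
      by (simp add: field_simps)
    then show "\<exists>d>0. \<forall>w. w \<in> input_seqs U \<and> seq_dist u w < d \<longrightarrow> dist (u k) (w k) < e"
      using \<open>e > 0\<close> by (intro exI[of _ "e / 2 powi \<bar>k\<bar>"]) auto
  qed auto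
  then have "continuous_map M.mtopology euclidean (\<lambda>u. u)"
    by (simp add: euclidean_product_topology[symmetric] continuous_map_componentwise_UNIV)
  then show ?thesis using image_compactin[OF V] by fastforce
qed

section \<open>Existence and attraction\<close>

lemma C1_on_imp_continuous_on:
  assumes "C1_on f S"
  shows "continuous_on S f"
  unfolding continuous_on_eq_continuous_within
proof
  fix p assume "p \<in> S"
  then obtain W g g' where W: "open W" "p \<in> W" "\<forall>x\<in>S \<inter> W. g x = f x"
    "\<forall>x\<in>W. (g has_derivative blinfun_apply (g' x)) (at x)"
    using assms unfolding C1_on_def by metis
  then have "continuous (at p within S) g"
    by (meson continuous_at_imp_continuous_at_within has_derivative_continuous)
  moreover have "\<forall>\<^sub>F x in at p within S. g x = f x"
    using W by (auto simp: eventually_at_topological)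
  moreover have "g p = f p" using W \<open>p \<in> S\<close> by simp
  ultimately show "continuous (at p within S) f"
    using tendsto_cong by (fastforce simp: continuous_within)
qed

locale absorbing_process =
  fixes X :: "'x::heine_borel set" and G :: "'u \<times> 'x \<Rightarrow> 'x" and v :: "int \<Rightarrow> 'u" and B :: "'x set"
  assumes cont: "\<And>k. continuous_on X (\<lambda>x. G (v k, x))"
    and maps: "\<And>k x. x \<in> X \<Longrightarrow> G (v k, x) \<in> X"
    and absorbing: "pullback_absorbing X G (shift_orbit v) B"
    and invariant: "positively_invariant G (shift_orbit v) B"
begin

abbreviation evol :: "nat \<Rightarrow> int \<Rightarrow> 'x \<Rightarrow> 'x" where
  "evol k m \<equiv> cocycle G k (shift_pow m v)"

text \<open>The states at time \<open>n\<close> of the trajectories that were in \<open>B\<close> at time \<open>n - j\<close>; indexing by the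
  elapsed time \<open>j\<close> makes this a sequence over the natural numbers.\<close>

definition nest :: "int \<Rightarrow> nat \<Rightarrow> 'x set" where
  "nest n j = evol j (n - int j) ` B"

definition fibre :: "int \<Rightarrow> 'x set" where
  "fibre n = (\<Inter>j. nest n j)"

lemma evol_add: "evol (j + k) m x = evol j (int k + m) (evol k m x)"
  by (simp add: cocycle_add shift_pow_shift_pow)

lemma evol_image_add: "evol (j + k) m ` D = evol j (int k + m) ` evol k m ` D"
  unfolding image_image by (rule image_cong) (auto simp: evol_add)

lemma evol_maps: "x \<in> X \<Longrightarrow> evol k m x \<in> X"
  by (induction k) (auto simp: shift_pow_apply maps)

lemma evol_cont: "continuous_on X (evol k m)"
proof (induction k)
  case (Suc k)
  have "continuous_on X ((\<lambda>x. G (v (int (Suc k) + m), x)) \<circ> evol k m)"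
    using Suc by (intro continuous_on_compose continuous_on_subset[OF cont]) (auto intro: evol_maps)
  moreover have "evol (Suc k) m = (\<lambda>x. G (v (int (Suc k) + m), x)) \<circ> evol k m"
    by (rule ext) (simp add: shift_pow_apply)
  ultimately show ?case by simp
qed simp

lemma evol_B: "evol k m ` B \<subseteq> B"
  using invariant by (auto simp: positively_invariant_def)

lemma B: "B \<noteq> {}" "compact B" "B \<subseteq> X"
  using absorbing by (auto simp: pullback_absorbing_def)

lemma absorbed:
  assumes "D \<subseteq> X" "bounded D"
  shows "\<forall>\<^sub>F k in sequentially. evol k (n - int k) ` D \<subseteq> B"
proof -
  have "\<exists>N. \<forall>k\<ge>N. cocycle G k (shift_pow (- int k) (shift_pow n v)) ` D \<subseteq> B"
    using absorbing assms shift_pow_in_orbit unfolding pullback_absorbing_def by blast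
  then show ?thesis by (auto simp: shift_pow_shift_pow eventually_sequentially)
qed

lemma compact_nest_sets: "compact (nest n j)"
  unfolding nest_def
  using B by (intro compact_continuous_image continuous_on_subset[OF evol_cont])

text \<open>Whatever starts in \<open>B\<close> at time \<open>n - j\<close> is, by positive invariance, still in \<open>B\<close> at the later
  time \<open>n - i\<close>.\<close>

lemma antimono_nest: "antimono (nest n)"
proof (rule antimonoI)
  fix i j :: nat assume "i \<le> j"
  then have "nest n j = evol i (n - int i) ` evol (j - i) (n - int j) ` B"
    using evol_image_add[of i "j - i" "n - int j" B] by (simp add: nest_def of_nat_diff)
  also have "\<dots> \<subseteq> nest n i" unfolding nest_def by (rule image_mono) (rule evol_B)
  finally show "nest n j \<subseteq> nest n i" .
qed

lemma fibre_eq: "fibre n = (\<Inter>m\<in>{..n}. evol (nat (n - m)) m ` B)"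
proof -
  have "{..n} = range (\<lambda>j. n - int j)"
    by (auto simp: image_iff intro!: exI[of _ "nat (n - _)"])
  then show ?thesis by (simp add: fibre_def nest_def image_image)
qed

lemma fibre_subset: "fibre n \<subseteq> B"
  unfolding fibre_def nest_def by (rule INF_lower2[of 0]) auto

lemma compact_fibre: "compact (fibre n)"
  unfolding fibre_def by (rule compact_Inter) (auto simp: compact_nest_sets)

lemma fibre_nonempty: "fibre n \<noteq> {}"
  unfolding fibre_def using B(1)
  by (intro compact_nest compact_nest_sets antimonoD[OF antimono_nest]) (simp_all add: nest_def)

text \<open>The evolution over \<open>s\<close> steps commutes with the nested intersection and turns the sequence at
  time \<open>m\<close> into the tail, from index \<open>s\<close> on, of the one at time \<open>m + s\<close>; dropping an initial
  segment of a decreasing sequence does not change its intersection.\<close>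

lemma evol_fibre: "evol s m ` fibre m = fibre (int s + m)"
proof -
  have "evol s m ` fibre m = (\<Inter>j. evol s m ` nest m j)"
    unfolding fibre_def
    using B by (intro image_compact_nest compact_nest_sets antimono_nest
        continuous_on_subset[OF evol_cont]) (auto simp: nest_def)
  also have "\<dots> = (\<Inter>j. nest (int s + m) (s + j))"
    using evol_image_add[of s _ _ B] by (simp add: nest_def)
  also have "(\<Inter>j. nest (int s + m) (s + j)) = fibre (int s + m)"
    unfolding fibre_def
  proof (intro equalityI INF_greatest)
    show "(\<Inter>j. nest (int s + m) (s + j)) \<subseteq> nest (int s + m) i" for i
      by (rule INF_lower2[OF UNIV_I, of _ i]) (simp add: antimonoD[OF antimono_nest])
  qed auto
  finally show ?thesis .
qed

text \<open>Choose \<open>j\<close> with \<open>nest n j\<close> close to \<open>fibre n\<close>; a bounded set that starts early enough has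
  been absorbed by time \<open>n - j\<close> and so lies in \<open>nest n j\<close> at time \<open>n\<close>.\<close>

lemma pullback_attraction:
  assumes "D \<subseteq> X" "bounded D" "e > 0"
  shows "\<forall>\<^sub>F k in sequentially. hausdorff_semidist (evol k (n - int k) ` D) (fibre n) \<le> ennreal e"
proof -
  obtain j where j: "\<forall>y\<in>nest n j. \<exists>z\<in>fibre n. dist y z < e"
    using compact_nest_nearby[OF compact_nest_sets antimono_nest \<open>e > 0\<close>, of n]
    unfolding fibre_def by blast
  have "\<forall>\<^sub>F i in sequentially. evol (j + i) (n - int (j + i)) ` D \<subseteq> nest n j"
    using absorbed[OF assms(1,2), of "n - int j"]
  proof eventually_elim
    case (elim i)
    then show ?case
      using evol_image_add[of j i "n - int (j + i)" D] image_mono[OF elim, of "evol j (n - int j)"]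
      by (simp add: nest_def diff_diff_eq)
  qed
  then have "\<forall>\<^sub>F i in sequentially.
      hausdorff_semidist (evol (i + j) (n - int (i + j)) ` D) (fibre n) \<le> ennreal e"
    by (rule eventually_mono) (use j in \<open>auto intro!: hausdorff_semidist_le simp: add.commute\<close>)
  then show ?thesis by (rule eventually_sequentially_seg[THEN iffD1])
qed

lemma pullback_attractor_fibre: "pullback_attractor X G v fibre"
  unfolding pullback_attractor_def
proof (intro conjI allI impI)
  show "fibre n \<subseteq> X" for n using fibre_subset B(3) by (rule order_trans)
  show "(\<lambda>k. hausdorff_semidist (evol k (- int k + n) ` D) (fibre n)) \<longlonglongrightarrow> 0"
    if "D \<subseteq> X \<and> bounded D" for n D
    using pullback_attraction[of D _ n] that by (intro tendsto_0_ennrealI) simp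
qed (rule fibre_nonempty compact_fibre evol_fibre)+

text \<open>Evolving for \<open>k\<close> steps from time \<open>n\<close> is a pullback that ends at time \<open>n + k\<close>, along the
  input \<open>shift_pow (n + k) v\<close>. Although that end time is unbounded, only finitely many inputs occur,
  and the pullback rates can be made uniform over them.\<close>

lemma forward_attraction:
  assumes fin: "finite (shift_orbit v)" and D: "D \<subseteq> X" "bounded D" and "e > 0"
  shows "\<forall>\<^sub>F k in sequentially.
    \<forall>n. hausdorff_semidist (evol k n ` D) (closure (\<Union>n. fibre n)) \<le> ennreal e"
proof -
  let ?A = "closure (\<Union>n. fibre n)"
  have "\<forall>\<^sub>F k in sequentially. \<forall>w\<in>shift_orbit v.
      hausdorff_semidist (cocycle G k (shift_pow (- int k) w) ` D) ?A \<le> ennreal e"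
  proof (rule eventually_ball_finite[OF fin], rule ballI)
    fix w assume "w \<in> shift_orbit v"
    then obtain r where w: "w = shift_pow r v" by (auto simp: shift_orbit_def)
    have "fibre r \<subseteq> ?A" by (rule order_trans[OF UN_upper[OF UNIV_I] closure_subset])
    from pullback_attraction[OF D \<open>e > 0\<close>, of r]
    show "\<forall>\<^sub>F k in sequentially.
        hausdorff_semidist (cocycle G k (shift_pow (- int k) w) ` D) ?A \<le> ennreal e"
      by (rule eventually_mono)
        (simp add: w shift_pow_shift_pow
          order_trans[OF hausdorff_semidist_mono[OF order_refl \<open>fibre r \<subseteq> ?A\<close>]])
  qed
  then show ?thesis
  proof (rule eventually_mono, intro allI)
    fix k n
    assume *: "\<forall>w\<in>shift_orbit v.
      hausdorff_semidist (cocycle G k (shift_pow (- int k) w) ` D) ?A \<le> ennreal e"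
    show "hausdorff_semidist (evol k n ` D) ?A \<le> ennreal e"
      using bspec[OF *, of "shift_pow (int k + n) v"] by (simp add: shift_pow_shift_pow)
  qed
qed

lemma uniformly_attracts_bounded:
  assumes "finite (shift_orbit v)" "D \<subseteq> X" "bounded D"
  shows "uniformly_attracts G v D (closure (\<Union>n. fibre n))"
  unfolding uniformly_attracts_def
  by (rule tendsto_0_ennrealI, rule eventually_mono[OF forward_attraction[OF assms]])
    (auto intro: SUP_least)

text \<open>After \<open>k\<close> steps the whole space has entered one bounded set, a union over the finitely many
  points of the orbit.\<close>

lemma uniformly_attracts_space:
  assumes fin: "finite (shift_orbit v)" and bdd: "\<And>n. bounded (evol k n ` X)"
  shows "uniformly_attracts G v X (closure (\<Union>n. fibre n))"
proof -
  define D where "D = (\<Union>w\<in>shift_orbit v. cocycle G k w ` X)"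
  have "bounded D"
    unfolding D_def using fin bdd by (intro bounded_UN) (auto simp: shift_orbit_def)
  moreover have "D \<subseteq> X" by (auto simp: D_def shift_orbit_def evol_maps)
  ultimately have att: "\<forall>\<^sub>F j in sequentially.
      \<forall>n. hausdorff_semidist (evol j n ` D) (closure (\<Union>n. fibre n)) \<le> ennreal e"
    if "e > 0" for e
    using forward_attraction[OF fin _ _ that] by blast
  have sub: "evol (j + k) n ` X \<subseteq> evol j (int k + n) ` D" for j n
    unfolding evol_image_add D_def by (intro image_mono UN_upper shift_pow_in_orbit)
  have "\<forall>\<^sub>F j in sequentially.
      (SUP n. hausdorff_semidist (evol (j + k) n ` X) (closure (\<Union>n. fibre n))) \<le> ennreal e"
    if "e > 0" for e
    using att[OF that]
    by (rule eventually_mono)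
      (blast intro: SUP_least order_trans[OF hausdorff_semidist_mono[OF sub order_refl]])
  then have "\<forall>\<^sub>F j in sequentially.
      (SUP n. hausdorff_semidist (evol j n ` X) (closure (\<Union>n. fibre n))) \<le> ennreal e"
    if "e > 0" for e
    using that by (subst eventually_sequentially_seg[of _ k, symmetric])
  then show ?thesis unfolding uniformly_attracts_def by (rule tendsto_0_ennrealI)
qed

end

theorem propositionB4:
  fixes U :: "(real ^ 'i) set"
    and X :: "(real ^ 'r) set"
    and G :: "(real ^ 'i) \<times> (real ^ 'r) \<Rightarrow> real ^ 'r"
    and v :: "int \<Rightarrow> real ^ 'i"
    and B :: "(real ^ 'r) set"
  assumes "compact U"
    and "closed X"
    and "G ` (U \<times> X) \<subseteq> X"
    and "C1_on G (U \<times> X)"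
    and "\<And>u. u \<in> U \<Longrightarrow> local_diffeo_onto_image (\<lambda>x. G (u, x)) X"
    and "v \<in> input_seqs U"
    and "pullback_absorbing X G (shift_orbit v) B"
    and "positively_invariant G (shift_orbit v) B"
  shows "\<exists>A. pullback_attractor X G v A \<and>
      (\<forall>n. A n = (\<Inter>m\<in>{..n}. cocycle G (nat (n - m)) (shift_pow m v) ` B)) \<and>
      (compactin (Metric_space.mtopology (input_seqs U) seq_dist) (shift_orbit v) \<longrightarrow>
         closure (\<Union>n. A n) \<subseteq> B \<and>
         (\<forall>D. D \<subseteq> X \<and> bounded D \<longrightarrow> uniformly_attracts G v D (closure (\<Union>n. A n))) \<and>
         ((\<exists>k. \<forall>n. bounded (cocycle G k (shift_pow n v) ` X)) \<longrightarrow>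
            uniformly_attracts G v X (closure (\<Union>n. A n))))"
proof -
  have v: "v k \<in> U" for k using assms(6) by (auto simp: input_seqs_def)
  interpret absorbing_process X G v B
  proof
    show "continuous_on X (\<lambda>x. G (v k, x))" for k
      by (rule continuous_on_compose2[OF C1_on_imp_continuous_on[OF assms(4)]])
        (auto intro!: continuous_intros v)
    show "G (v k, x) \<in> X" if "x \<in> X" for k x using that v assms(3) by blast
  qed (fact assms)+
  have "finite (shift_orbit v)"
    if "compactin (Metric_space.mtopology (input_seqs U) seq_dist) (shift_orbit v)"
    using compactin_seq_dist_imp_compact[OF compact_imp_bounded[OF assms(1)] that]
    by (rule compact_shift_orbit_finite)
  moreover have "closure (\<Union>n. fibre n) \<subseteq> B"
    using fibre_subset compact_imp_closed[OF B(2)] by (intro closure_minimal) auto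
  ultimately show ?thesis
    by (intro exI[of _ fibre] conjI allI impI pullback_attractor_fibre fibre_eq)
      (blast intro: uniformly_attracts_bounded uniformly_attracts_space)+
qed

end
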